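(* Let $n\geq 2$ be an integer, let $N=\{1,\ldots,n\}$, and let $\bm{a},\bm{b}\in\mathbb{R}^n$ satisfy $0\leq a_i<b_i$ for all $i\in N$ and $a_i=0$ for $i=1,\ldots,n-1$. Let \[ C_n^1=\operatorname{conv}\left\{(\bm{x},y)\in\mathbb{R}^{n}\times\mathbb{R} : a_i\leq x_i\leq b_i \text{ for all } i\in N,\ y=\prod_{i=1}^n x_i\right\}. \] Then $C_n^1$ is exactly the set of all $(\bm{x},y)\in\mathbb{R}^n\times\mathbb{R}$ satisfying the following system of linear inequalities: \begin{align*} y-\sum_{i\in N\setminus\{n\}}\left(a_n\prod_{j\in N\setminus\{i,n\}}b_j\right)x_i+(n-2)\,a_n\prod_{j\in N\setminus\{n\}}b_j&\geq 0;\\ y-\sum_{i\in N}\left(\prod_{j\in N\setminus\{i\}}b_j\right)x_i+(n-1)\prod_{j\in N}b_j&\geq 0;\\ -y+\left(a_n\prod_{j\in N\setminus\{i,n\}}b_j\right)x_i+\left(\prod_{j\in N\setminus\{n\}}b_j\right)x_n-a_n\prod_{j\in N\setminus\{n\}}b_j&\geq 0,\quad i\in N\setminus\{n\};\\ -y+\left(\prod_{j\in N\setminus\{i\}}b_j\right)x_i&\geq 0,\quad i\in N\setminus\{n\};\\ y&\geq 0;\\ x_i&\leq b_i,\quad i\in N;\\ x_n&\geq a_n. \end{align*}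
   Context: $\operatorname{conv}$ denotes the convex hull. Empty products equal $1$ (this occurs for $\prod_{j\in N\setminus\{i,n\}}b_j$ when $n=2$). $C_n^1$ is the convex hull of the graph of the monomial $x_1x_2\cdots x_n$ over the box $[\bm{a},\bm{b}]$, in the case where at most one variable (taken to be $x_n$) has a nonzero lower bound; $a_n=0$ is allowed. *)

theory Defs
  imports "HOL-Analysis.Analysis"
begin

(* The index set N = {1, ..., n} is rendered by a finite type 'n with CARD('n) = n.
   The label n of the last variable is a matter of numbering only; where that variable
   plays a special role it is named explicitly as an element of 'n. *)

definition monomial_graph :: "real ^ 'n \<Rightarrow> real ^ 'n \<Rightarrow> ((real ^ 'n) \<times> real) set" where
  "monomial_graph a b =
     {(x, y). (\<forall>i. a $ i \<le> x $ i \<and> x $ i \<le> b $ i) \<and> y = (\<Prod>i\<in>UNIV. x $ i)}"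

definition monomial_hull :: "real ^ 'n \<Rightarrow> real ^ 'n \<Rightarrow> ((real ^ 'n) \<times> real) set" where
  "monomial_hull a b = convex hull (monomial_graph a b)"

end

theory Submission
  imports Defs
begin

text \<open>
  Dividing each \<open>x\<^sub>i\<close> with \<open>i \<noteq> m\<close> by \<open>b\<^sub>i\<close> and \<open>y\<close> by the product of these bounds is a linear
  bijection, so one may assume that every variable but the \<open>m\<close>-th ranges over \<open>[0, 1]\<close>, while
  \<open>t = u\<^sub>m\<close> ranges over \<open>[\<alpha>, \<beta>]\<close>. Write \<open>v\<close> for the total slack, the sum of \<open>1 - u\<^sub>i\<close> over
  \<open>i \<noteq> m\<close>, and \<open>w\<close> for the least \<open>u\<^sub>i\<close> with \<open>i \<noteq> m\<close>. The system then says that \<open>z\<close> lies between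
  the lower envelope \<open>max {0, \<alpha> (1 - v), t - \<beta> v}\<close> and the upper envelope
  \<open>min {\<beta> w, \<alpha> w + t - \<alpha>}\<close>.

  A point of the convex hull is the mean of a random point \<open>(U, T)\<close> of the box together with the
  mean of the monomial. The hull meets each vertical line in a convex set, so it suffices to reach
  both envelopes by a suitable coupling of the coordinates.

  \<^item> For the upper envelope, the coordinates are made to be nonzero as simultaneously as possible:
    with weight \<open>w\<close> all of them are \<open>1\<close>, and otherwise the coordinate with the least mean is \<open>0\<close>.
    The larger values of \<open>T\<close> go as far as possible to the first event
    (\<open>upper_envelope_mem_hull\<close>).
  \<^item> For the lower envelope, the coordinates are made to vanish as disjointly as possible. If
    \<open>v \<ge> 1\<close>, some coordinate can be made to vanish at every point of the mixture, which gives
    \<open>z = 0\<close> (\<open>zero_mem_hull\<close>). If \<open>v < 1\<close>, this can be done on an event of weight \<open>v\<close>, and the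
    larger values of \<open>T\<close> go as far as possible to that event (\<open>lower_envelope_mem_hull\<close>).

  Conversely, the inequalities are linear, so they need only be checked on the graph
  (\<open>normalised_graph_subset_system\<close>).
\<close>

section \<open>The normalised monomial and its linear description\<close>

definition slack :: "'n \<Rightarrow> real ^ 'n \<Rightarrow> real" where
  "slack m u = (\<Sum>i\<in>UNIV - {m}. 1 - u $ i)"

definition normalised_graph :: "real \<Rightarrow> real \<Rightarrow> 'n \<Rightarrow> ((real ^ 'n) \<times> real) set" where
  "normalised_graph \<alpha> \<beta> m =
     {(u, z). (\<forall>i. i \<noteq> m \<longrightarrow> 0 \<le> u $ i \<and> u $ i \<le> 1) \<and> \<alpha> \<le> u $ m \<and> u $ m \<le> \<beta> \<and>
        z = u $ m * (\<Prod>i\<in>UNIV - {m}. u $ i)}"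

definition normalised_system :: "real \<Rightarrow> real \<Rightarrow> 'n \<Rightarrow> ((real ^ 'n) \<times> real) set" where
  "normalised_system \<alpha> \<beta> m =
     {(u, z). \<alpha> * (1 - slack m u) \<le> z \<and> u $ m - \<beta> * slack m u \<le> z \<and>
        (\<forall>i. i \<noteq> m \<longrightarrow> z \<le> \<alpha> * u $ i + u $ m - \<alpha>) \<and>
        (\<forall>i. i \<noteq> m \<longrightarrow> z \<le> \<beta> * u $ i) \<and> 0 \<le> z \<and>
        (\<forall>i. i \<noteq> m \<longrightarrow> u $ i \<le> 1) \<and> \<alpha> \<le> u $ m \<and> u $ m \<le> \<beta>}"

lemma slack_nonneg:
  fixes u :: "real ^ 'n"
  assumes "\<And>i. i \<noteq> m \<Longrightarrow> u $ i \<le> 1"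
  shows "0 \<le> slack m u"
  unfolding slack_def using assms by (intro sum_nonneg) auto

lemma one_minus_le_slack:
  fixes u :: "real ^ 'n"
  assumes "\<And>i. i \<noteq> m \<Longrightarrow> u $ i \<le> 1" and "j \<noteq> m"
  shows "1 - u $ j \<le> slack m u"
  unfolding slack_def
  using assms by (intro member_le_sum[where f = "\<lambda>i. 1 - u $ i"]) auto

lemma slack_convex_combination:
  fixes u w :: "real ^ 'n"
  assumes "s + t = 1"
  shows "slack m (s *\<^sub>R u + t *\<^sub>R w) = s * slack m u + t * slack m w"
proof -
  have "slack m (s *\<^sub>R u + t *\<^sub>R w) = (\<Sum>i\<in>UNIV - {m}. s * (1 - u $ i) + t * (1 - w $ i))"
    unfolding slack_def using assms
    by (intro sum.cong) (auto simp: algebra_simps simp flip: distrib_right)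
  then show ?thesis
    by (simp add: slack_def sum.distrib sum_distrib_left)
qed

text \<open>The union bound: if independent events have probabilities \<open>f i\<close>, the product is the probability
  that all of them occur, and the sum bounds the probability that one of them fails.\<close>

lemma one_minus_sum_le_prod:
  fixes f :: "'a \<Rightarrow> real"
  assumes "finite I" and "\<And>i. i \<in> I \<Longrightarrow> 0 \<le> f i \<and> f i \<le> 1"
  shows "1 - (\<Sum>i\<in>I. 1 - f i) \<le> (\<Prod>i\<in>I. f i)"
  using assms
proof (induction I rule: finite_induct)
  case (insert j I)
  have "0 \<le> (\<Prod>i\<in>I. f i)" "(\<Prod>i\<in>I. f i) \<le> 1"
    using insert.prems by (auto intro: prod_nonneg prod_le_1)
  then have "(1 - f j) * (1 - (\<Prod>i\<in>I. f i)) \<ge> 0"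
    using insert.prems by (intro mult_nonneg_nonneg) auto
  moreover have "1 - (\<Sum>i\<in>I. 1 - f i) \<le> (\<Prod>i\<in>I. f i)"
    using insert by auto
  ultimately show ?case
    using insert.hyps by (simp add: algebra_simps)
qed simp

lemma prod_le_member:
  fixes f :: "'a \<Rightarrow> real"
  assumes "finite I" and "\<And>i. i \<in> I \<Longrightarrow> 0 \<le> f i \<and> f i \<le> 1" and "j \<in> I"
  shows "(\<Prod>i\<in>I. f i) \<le> f j"
proof -
  have "(\<Prod>i\<in>I - {j}. f i) \<le> 1"
    using assms by (intro prod_le_1) auto
  then have "f j * (\<Prod>i\<in>I - {j}. f i) \<le> f j * 1"
    using assms by (intro mult_left_mono) auto
  then show ?thesis
    using prod.remove[OF assms(1,3), of f] by simp
qed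

section \<open>Validity of the inequalities\<close>

text \<open>With \<open>p\<close> the product of the \<open>u\<^sub>i\<close>, \<open>i \<noteq> m\<close>, the lower bounds come from \<open>p \<ge> 1 - v\<close> and the upper
  bounds from \<open>p \<le> u\<^sub>i\<close>; what remains is that the bilinear terms \<open>t p\<close>, \<open>t v\<close> and \<open>t u\<^sub>i\<close> are
  bounded by their linear estimates at \<open>t = \<alpha>\<close> or \<open>t = \<beta>\<close>.\<close>

lemma normalised_graph_subset_system:
  fixes m :: "'n::finite"
  assumes "0 \<le> \<alpha>"
  shows "normalised_graph \<alpha> \<beta> m \<subseteq> normalised_system \<alpha> \<beta> m"
proof (rule subsetI, clarify)
  fix u :: "real ^ 'n" and z :: real
  assume "(u, z) \<in> normalised_graph \<alpha> \<beta> m"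
  then have u: "\<And>i. i \<noteq> m \<Longrightarrow> 0 \<le> u $ i \<and> u $ i \<le> 1" and t: "\<alpha> \<le> u $ m" "u $ m \<le> \<beta>"
    and z: "z = u $ m * (\<Prod>i\<in>UNIV - {m}. u $ i)"
    by (auto simp: normalised_graph_def)
  define p where "p = (\<Prod>i\<in>UNIV - {m}. u $ i)"
  have p: "1 - slack m u \<le> p" "0 \<le> p"
    unfolding p_def slack_def using u by (auto intro!: one_minus_sum_le_prod prod_nonneg)
  have v: "0 \<le> slack m u"
    using u by (intro slack_nonneg) auto
  have z_p: "z = u $ m * p" using z by (simp add: p_def)
  have "\<alpha> * (1 - slack m u) \<le> \<alpha> * p"
    using p assms by (intro mult_left_mono)
  also have "\<dots> \<le> z"
    unfolding z_p using p t by (intro mult_right_mono)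
  finally have 1: "\<alpha> * (1 - slack m u) \<le> z" .
  have "u $ m - \<beta> * slack m u \<le> u $ m * (1 - slack m u)"
    using mult_right_mono[OF t(2) v] by (simp add: algebra_simps)
  also have "\<dots> \<le> z"
    unfolding z_p using p t assms by (intro mult_left_mono) auto
  finally have 2: "u $ m - \<beta> * slack m u \<le> z" .
  have z_le: "z \<le> u $ m * u $ i" if "i \<noteq> m" for i
    unfolding z_p p_def using that u t assms by (intro mult_left_mono prod_le_member) auto
  have 3: "z \<le> \<alpha> * u $ i + u $ m - \<alpha>" if "i \<noteq> m" for i
  proof -
    \<comment> \<open>the McCormick estimate of the product \<open>u\<^sub>m u\<^sub>i\<close> from above\<close>
    have "0 \<le> (u $ m - \<alpha>) * (1 - u $ i)"
      using u that t by auto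
    with z_le[OF that] show ?thesis by (simp add: algebra_simps)
  qed
  have 4: "z \<le> \<beta> * u $ i" if "i \<noteq> m" for i
    using z_le[OF that] mult_right_mono[OF t(2), of "u $ i"] u that by fastforce
  have "0 \<le> z"
    unfolding z_p using p t assms by auto
  with 1 2 3 4 u t show "(u, z) \<in> normalised_system \<alpha> \<beta> m"
    by (auto simp: normalised_system_def)
qed

lemma convex_combination_le:
  fixes s t p q p' q' :: real
  assumes "p \<le> q" and "p' \<le> q'" and "0 \<le> s" and "0 \<le> t"
  shows "s * p + t * p' \<le> s * q + t * q'"
  using assms by (intro add_mono mult_left_mono)

lemma convex_normalised_system:
  fixes m :: "'n::finite"
  shows "convex (normalised_system \<alpha> \<beta> m)"
proof (rule convexI, clarify)
  fix u w :: "real ^ 'n" and y z s t :: real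
  assume "(u, y) \<in> normalised_system \<alpha> \<beta> m" and "(w, z) \<in> normalised_system \<alpha> \<beta> m"
    and s: "0 \<le> s" and t: "0 \<le> t" and st: "s + t = 1"
  then have *: "\<alpha> * (1 - slack m u) \<le> y" "u $ m - \<beta> * slack m u \<le> y"
    "\<And>i. i \<noteq> m \<Longrightarrow> y \<le> \<alpha> * u $ i + u $ m - \<alpha>" "\<And>i. i \<noteq> m \<Longrightarrow> y \<le> \<beta> * u $ i" "0 \<le> y"
    "\<And>i. i \<noteq> m \<Longrightarrow> u $ i \<le> 1" "\<alpha> \<le> u $ m" "u $ m \<le> \<beta>"
    "\<alpha> * (1 - slack m w) \<le> z" "w $ m - \<beta> * slack m w \<le> z"
    "\<And>i. i \<noteq> m \<Longrightarrow> z \<le> \<alpha> * w $ i + w $ m - \<alpha>" "\<And>i. i \<noteq> m \<Longrightarrow> z \<le> \<beta> * w $ i" "0 \<le> z"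
    "\<And>i. i \<noteq> m \<Longrightarrow> w $ i \<le> 1" "\<alpha> \<le> w $ m" "w $ m \<le> \<beta>"
    by (auto simp: normalised_system_def)
  note mix = convex_combination_le[OF _ _ s t]
  have t_eq: "t = 1 - s" using st by simp
  show "s *\<^sub>R (u, y) + t *\<^sub>R (w, z) \<in> normalised_system \<alpha> \<beta> m"
    using mix[OF *(1) *(9)] mix[OF *(2) *(10)] mix[OF *(3) *(11)] mix[OF *(4) *(12)]
      mix[OF *(5) *(13)] mix[OF *(6) *(14)] mix[OF *(7) *(15)] mix[OF *(8) *(16)]
    unfolding normalised_system_def scaleR_Pair add_Pair mem_Collect_eq prod.case
      slack_convex_combination[OF st]
    by (simp add: t_eq algebra_simps)
qed

section \<open>Reaching the envelopes\<close>

lemma mixture_mem: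
  fixes u :: "real ^ 'n"
  assumes "convex S" and "(u1, z1) \<in> S" and "(u2, z2) \<in> S" and "0 \<le> l" and "l \<le> 1"
    and "\<And>i. u $ i = l * u1 $ i + (1 - l) * u2 $ i" and "z = l * z1 + (1 - l) * z2"
  shows "(u, z) \<in> S"
proof -
  have "l *\<^sub>R (u1, z1) + (1 - l) *\<^sub>R (u2, z2) \<in> S"
    using assms by (intro convexD) auto
  moreover have "l *\<^sub>R (u1, z1) + (1 - l) *\<^sub>R (u2, z2) = (u, z)"
    using assms(6,7) by (simp add: vec_eq_iff)
  ultimately show ?thesis by simp
qed

lemma normalised_graph_mem_hull:
  fixes m :: "'n::finite"
  assumes "\<And>i. i \<noteq> m \<Longrightarrow> 0 \<le> u $ i \<and> u $ i \<le> 1" and "\<alpha> \<le> u $ m" and "u $ m \<le> \<beta>"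
    and "z = u $ m * (\<Prod>i\<in>UNIV - {m}. u $ i)"
  shows "(u, z) \<in> convex hull normalised_graph \<alpha> \<beta> m"
  using assms by (intro hull_inc) (auto simp: normalised_graph_def)

text \<open>Any point with total slack \<open>v \<ge> 1\<close> is a mixture of points at which some coordinate is \<open>0\<close>: the
  \<open>j\<close>-th coordinate is put to \<open>0\<close> with weight \<open>l\<^sub>j = (1 - u\<^sub>j) / v\<close>. Since \<open>v \<ge> 1\<close>, this weight does not
  exceed \<open>1 - u\<^sub>j\<close>, so on the remaining weight \<open>1 - l\<^sub>j\<close> the coordinate can take the constant value
  \<open>u\<^sub>j / (1 - l\<^sub>j) \<le> 1\<close> that corrects its mean.\<close>

lemma zero_mem_hull:
  fixes m :: "'n::finite" and u :: "real ^ 'n"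
  assumes u: "\<And>i. i \<noteq> m \<Longrightarrow> 0 \<le> u $ i \<and> u $ i \<le> 1" and t: "\<alpha> \<le> u $ m" "u $ m \<le> \<beta>"
    and v: "1 \<le> slack m u"
  shows "(u, 0) \<in> convex hull normalised_graph \<alpha> \<beta> m"
proof -
  let ?I = "UNIV - {m}"
  define l where "l i = (1 - u $ i) / slack m u" for i
  define p where "p j = (\<chi> i. if i = m then u $ m else if i = j then 0 else u $ i / (1 - l i))" for j
  have l_nonneg: "0 \<le> l i" and l_le: "l i \<le> 1 - u $ i" if "i \<in> ?I" for i
  proof -
    show "0 \<le> l i" using u[of i] v that by (auto simp: l_def)
    have "(1 - u $ i) * 1 \<le> (1 - u $ i) * slack m u"
      using u[of i] v that by (intro mult_left_mono) auto
    then show "l i \<le> 1 - u $ i" using v by (simp add: l_def field_simps)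
  qed
  have l_sum: "sum l ?I = 1"
    using v by (simp add: l_def slack_def flip: sum_divide_distrib)
  have p_mem: "(p j, 0) \<in> convex hull normalised_graph \<alpha> \<beta> m" if "j \<in> ?I" for j
  proof (rule normalised_graph_mem_hull)
    fix i assume "i \<noteq> m"
    then show "0 \<le> p j $ i \<and> p j $ i \<le> 1"
      using u[of i] l_le[of i] by (auto simp: p_def divide_simps)
  next
    have "\<exists>i\<in>?I. p j $ i = 0"
      using that by (auto simp: p_def)
    then have "(\<Prod>i\<in>?I. p j $ i) = 0"
      by (simp add: prod_zero_iff)
    then show "0 = p j $ m * (\<Prod>i\<in>?I. p j $ i)"
      by simp
  qed (use t in \<open>auto simp: p_def\<close>)
  have "(\<Sum>j\<in>?I. l j *\<^sub>R (p j, 0::real)) \<in> convex hull normalised_graph \<alpha> \<beta> m"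
    using l_sum l_nonneg p_mem by (intro convex_sum) auto
  moreover have "(\<Sum>j\<in>?I. l j *\<^sub>R p j) = u"
  proof (rule vec_eq_iff[THEN iffD2], rule allI)
    fix i
    show "(\<Sum>j\<in>?I. l j *\<^sub>R p j) $ i = u $ i"
    proof (cases "i = m")
      case True
      then show ?thesis
        using l_sum by (simp add: p_def flip: sum_distrib_right)
    next
      case False
      then have i: "i \<in> ?I" by simp
      have "(\<Sum>j\<in>?I. l j *\<^sub>R p j) $ i = (\<Sum>j\<in>?I - {i}. l j * (u $ i / (1 - l i)))"
        using False by (simp add: sum.remove[OF _ i] p_def) (rule sum.cong, auto)
      also have "\<dots> = sum l (?I - {i}) * (u $ i / (1 - l i))"
        by (rule sum_distrib_right[symmetric])
      also have "sum l (?I - {i}) = 1 - l i"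
        using l_sum by (simp add: sum.remove[OF _ i])
      \<comment> \<open>if \<open>l i = 1\<close>, then \<open>u $ i = 0\<close> and the quotient is \<open>0\<close> by convention\<close>
      also have "(1 - l i) * (u $ i / (1 - l i)) = u $ i"
        using l_le[OF i] u[of i] False by (cases "l i = 1") auto
      finally show ?thesis .
    qed
  qed
  ultimately show ?thesis
    by (simp add: sum_prod)
qed

text \<open>The point is a mixture, with weights \<open>v\<close> and \<open>1 - v\<close>, of a point of total slack exactly \<open>1\<close>, at
  height \<open>0\<close>, and a point whose coordinates other than the \<open>m\<close>-th are all \<open>1\<close>, at height \<open>t1\<close>. The
  values \<open>t0\<close> and \<open>t1\<close> of the \<open>m\<close>-th coordinate at these points are only tied by their mean, so
  \<open>t1\<close> can be lowered until either \<open>t0\<close> reaches \<open>\<beta>\<close> or \<open>t1\<close> reaches \<open>\<alpha>\<close>; the two cases give the two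
  terms of the maximum.\<close>

lemma lower_envelope_mem_hull:
  fixes m :: "'n::finite" and u :: "real ^ 'n"
  assumes u: "\<And>i. i \<noteq> m \<Longrightarrow> 0 \<le> u $ i \<and> u $ i \<le> 1" and t: "\<alpha> \<le> u $ m" "u $ m \<le> \<beta>"
    and v: "slack m u < 1"
  shows "(u, max (\<alpha> * (1 - slack m u)) (u $ m - \<beta> * slack m u))
    \<in> convex hull normalised_graph \<alpha> \<beta> m"
proof (cases "slack m u = 0")
  case True
  then have "u $ i = 1" if "i \<noteq> m" for i
    using one_minus_le_slack[of m u i] u that by fastforce
  then show ?thesis
    using True t by (intro normalised_graph_mem_hull) auto
next
  case False
  define v where "v = slack m u"
  have v01: "0 < v" "v < 1"
    using False v slack_nonneg[of m u] u by (auto simp: v_def less_le)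
  have mem: "(u, (1 - v) * t1) \<in> convex hull normalised_graph \<alpha> \<beta> m"
    if t1: "\<alpha> \<le> t1" "t1 \<le> \<beta>" and t0: "\<alpha> \<le> t0" "t0 \<le> \<beta>"
      and mean: "u $ m = v * t0 + (1 - v) * t1" for t0 t1
  proof -
    \<comment> \<open>the whole slack of \<open>u\<close> is concentrated on weight \<open>v\<close>\<close>
    define w where "w = (\<chi> i. if i = m then t0 else 1 - (1 - u $ i) / v)"
    define e :: "real ^ 'n" where "e = (\<chi> i. if i = m then t1 else 1)"
    have "(w, 0) \<in> convex hull normalised_graph \<alpha> \<beta> m"
    proof (rule zero_mem_hull)
      fix i assume "i \<noteq> m"
      then show "0 \<le> w $ i \<and> w $ i \<le> 1"
        using one_minus_le_slack[of m u i] u v01 by (auto simp: w_def v_def divide_simps)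
    next
      have "slack m w = (\<Sum>i\<in>UNIV - {m}. (1 - u $ i) / v)"
        unfolding slack_def by (intro sum.cong) (auto simp: w_def)
      also have "\<dots> = 1"
        using v01 by (simp add: v_def slack_def flip: sum_divide_distrib)
      finally show "1 \<le> slack m w" by simp
    qed (use t0 in \<open>auto simp: w_def\<close>)
    moreover have "(e, t1) \<in> convex hull normalised_graph \<alpha> \<beta> m"
      using t1 by (intro normalised_graph_mem_hull) (auto simp: e_def)
    ultimately show ?thesis
      by (rule mixture_mem[OF convex_convex_hull, where l = v])
        (use v01 mean in \<open>auto simp: w_def e_def field_simps\<close>)
  qed
  show ?thesis
  proof (cases "\<alpha> * (1 - v) \<le> u $ m - \<beta> * v")
    case True
    have "\<alpha> \<le> (u $ m - \<beta> * v) / (1 - v)" "(u $ m - \<beta> * v) / (1 - v) \<le> \<beta>"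
      using True v01 t by (auto simp: pos_le_divide_eq pos_divide_le_eq algebra_simps)
    then have "(u, (1 - v) * ((u $ m - \<beta> * v) / (1 - v))) \<in> convex hull normalised_graph \<alpha> \<beta> m"
      using v01 t by (intro mem[of _ \<beta>]) auto
    with True v01 show ?thesis
      by (simp add: v_def max_def)
  next
    case False
    have "\<alpha> \<le> (u $ m - \<alpha> * (1 - v)) / v" "(u $ m - \<alpha> * (1 - v)) / v \<le> \<beta>"
      using False v01 t by (auto simp: pos_le_divide_eq pos_divide_le_eq algebra_simps)
    then have "(u, (1 - v) * \<alpha>) \<in> convex hull normalised_graph \<alpha> \<beta> m"
      using v01 t by (intro mem[of _ "(u $ m - \<alpha> * (1 - v)) / v"]) auto
    with False show ?thesis
      by (simp add: v_def max_def mult.commute)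
  qed
qed

text \<open>With \<open>w = u $ k\<close>, the point is a mixture, with weights \<open>w\<close> and \<open>1 - w\<close>, of a point whose
  coordinates other than the \<open>m\<close>-th are all \<open>1\<close>, at height \<open>t1\<close>, and a point whose \<open>k\<close>-th coordinate
  is \<open>0\<close>, at height \<open>0\<close>; the latter lies in the box because \<open>w\<close> is minimal. Raising \<open>t1\<close> at
  constant mean stops when \<open>t1\<close> reaches \<open>\<beta>\<close> or \<open>t0\<close> reaches \<open>\<alpha>\<close>; the two cases give the two terms of
  the minimum.\<close>

lemma upper_envelope_mem_hull:
  fixes m k :: "'n::finite" and u :: "real ^ 'n"
  assumes u: "\<And>i. i \<noteq> m \<Longrightarrow> 0 \<le> u $ i \<and> u $ i \<le> 1" and t: "\<alpha> \<le> u $ m" "u $ m \<le> \<beta>"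
    and k: "k \<noteq> m" and k_min: "\<And>i. i \<noteq> m \<Longrightarrow> u $ k \<le> u $ i"
  shows "(u, min (\<beta> * u $ k) (\<alpha> * u $ k + u $ m - \<alpha>)) \<in> convex hull normalised_graph \<alpha> \<beta> m"
proof -
  define w where "w = u $ k"
  have w01: "0 \<le> w" "w \<le> 1" using u k by (auto simp: w_def)
  have mem: "(u, w * t1) \<in> convex hull normalised_graph \<alpha> \<beta> m"
    if t1: "\<alpha> \<le> t1" "t1 \<le> \<beta>" and t0: "\<alpha> \<le> t0" "t0 \<le> \<beta>"
      and mean: "u $ m = w * t1 + (1 - w) * t0" for t0 t1
  proof -
    define e :: "real ^ 'n" where "e = (\<chi> i. if i = m then t1 else 1)"
    define r where "r = (\<chi> i. if i = m then t0 else (u $ i - w) / (1 - w))"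
    have w_le: "w \<le> u $ i" "u $ i \<le> 1" if "i \<noteq> m" for i
      using k_min u that by (auto simp: w_def)
    have "(e, t1) \<in> convex hull normalised_graph \<alpha> \<beta> m"
      using t1 by (intro normalised_graph_mem_hull) (auto simp: e_def)
    moreover have "(r, 0) \<in> convex hull normalised_graph \<alpha> \<beta> m"
    proof (rule normalised_graph_mem_hull)
      fix i assume "i \<noteq> m"
      then show "0 \<le> r $ i \<and> r $ i \<le> 1"
        using w_le[of i] w01 by (auto simp: r_def divide_simps)
    next
      have "r $ k = 0" using k by (simp add: r_def w_def)
      then have "(\<Prod>i\<in>UNIV - {m}. r $ i) = 0"
        using k by (auto simp: prod_zero_iff)
      then show "0 = r $ m * (\<Prod>i\<in>UNIV - {m}. r $ i)" by simp
    qed (use t0 in \<open>auto simp: r_def\<close>)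
    ultimately show ?thesis
    proof (rule mixture_mem[OF convex_convex_hull, where l = w])
      fix i
      show "u $ i = w * e $ i + (1 - w) * r $ i"
        using mean w_le[of i] w01 by (cases "w = 1") (auto simp: e_def r_def)
    qed (use w01 in auto)
  qed
  show ?thesis
  proof (cases "\<beta> * w \<le> \<alpha> * w + u $ m - \<alpha>")
    case True
    show ?thesis
    proof (cases "w = 1")
      case True
      with \<open>\<beta> * w \<le> \<alpha> * w + u $ m - \<alpha>\<close> t have "u $ m = \<beta>" by simp
      with True t show ?thesis
        using mem[of \<beta> \<beta>] by (simp add: w_def)
    next
      case False
      with w01 have "w < 1" by simp
      then have "\<alpha> \<le> (u $ m - \<beta> * w) / (1 - w)" "(u $ m - \<beta> * w) / (1 - w) \<le> \<beta>"
        using True t by (auto simp: pos_le_divide_eq pos_divide_le_eq algebra_simps)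
      then have "(u, w * \<beta>) \<in> convex hull normalised_graph \<alpha> \<beta> m"
        using \<open>w < 1\<close> t by (intro mem[of _ "(u $ m - \<beta> * w) / (1 - w)"]) auto
      with True show ?thesis
        by (simp add: w_def min_def mult.commute)
    qed
  next
    case False
    with t have "w \<noteq> 0" by auto
    with w01 have "0 < w" by simp
    then have "\<alpha> \<le> (\<alpha> * w + u $ m - \<alpha>) / w" "(\<alpha> * w + u $ m - \<alpha>) / w \<le> \<beta>"
      using False t by (auto simp: pos_le_divide_eq pos_divide_le_eq algebra_simps)
    then have "(u, w * ((\<alpha> * w + u $ m - \<alpha>) / w)) \<in> convex hull normalised_graph \<alpha> \<beta> m"
      using \<open>0 < w\<close> t by (intro mem[of _ \<alpha>]) (simp_all, simp add: algebra_simps)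
    with False \<open>0 < w\<close> show ?thesis
      by (simp add: w_def min_def)
  qed
qed

text \<open>The bounds \<open>0 \<le> u\<^sub>i\<close> are implied by \<open>0 \<le> z \<le> \<beta> u\<^sub>i\<close>. At least two variables are required for the
  upper envelope to be the minimum over a nonempty set of coordinates.\<close>

lemma convex_hull_normalised_graph:
  fixes m :: "'n::finite"
  assumes "CARD('n) \<ge> 2" and \<alpha>: "0 \<le> \<alpha>" and \<beta>: "0 < \<beta>"
  shows "convex hull normalised_graph \<alpha> \<beta> m = normalised_system \<alpha> \<beta> m"
proof
  show "convex hull normalised_graph \<alpha> \<beta> m \<subseteq> normalised_system \<alpha> \<beta> m"
    using \<alpha> by (intro hull_minimal normalised_graph_subset_system convex_normalised_system)
  show "normalised_system \<alpha> \<beta> m \<subseteq> convex hull normalised_graph \<alpha> \<beta> m"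
  proof (rule subsetI, clarify)
    fix u :: "real ^ 'n" and z :: real
    assume "(u, z) \<in> normalised_system \<alpha> \<beta> m"
    then have sys: "\<alpha> * (1 - slack m u) \<le> z" "u $ m - \<beta> * slack m u \<le> z"
      "\<And>i. i \<noteq> m \<Longrightarrow> z \<le> \<alpha> * u $ i + u $ m - \<alpha>" "\<And>i. i \<noteq> m \<Longrightarrow> z \<le> \<beta> * u $ i" "0 \<le> z"
      "\<And>i. i \<noteq> m \<Longrightarrow> u $ i \<le> 1" and t: "\<alpha> \<le> u $ m" "u $ m \<le> \<beta>"
      by (auto simp: normalised_system_def)
    have u: "0 \<le> u $ i \<and> u $ i \<le> 1" if "i \<noteq> m" for i
    proof -
      have "0 \<le> \<beta> * u $ i" using sys(4)[OF that] sys(5) by simp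
      with \<beta> sys(6)[OF that] show ?thesis by (simp add: zero_le_mult_iff)
    qed
    obtain lo where lo: "lo \<le> z" "(u, lo) \<in> convex hull normalised_graph \<alpha> \<beta> m"
    proof (cases "slack m u < 1")
      case True
      from lower_envelope_mem_hull[OF u t True] sys(1,2) show ?thesis
        by (intro that) auto
    next
      case False
      then show ?thesis
        using zero_mem_hull[OF u t] sys(5) by (intro that[of 0]) auto
    qed
    have "UNIV - {m} \<noteq> {}"
    proof
      assume "UNIV - {m} = {}"
      then have "card (UNIV :: 'n set) \<le> card {m}" by (intro card_mono) auto
      with assms(1) show False by simp
    qed
    then obtain k where k: "k \<in> UNIV - {m}" "\<And>i. i \<in> UNIV - {m} \<Longrightarrow> u $ k \<le> u $ i"
      using ex_min_if_finite[of "(\<lambda>i. u $ i) ` (UNIV - {m})"] by (fastforce simp: not_less)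
    define hi where "hi = min (\<beta> * u $ k) (\<alpha> * u $ k + u $ m - \<alpha>)"
    have hi: "z \<le> hi" "(u, hi) \<in> convex hull normalised_graph \<alpha> \<beta> m"
      unfolding hi_def using upper_envelope_mem_hull[OF u t, of k] k sys(3,4) by auto
    obtain l where l: "0 \<le> l" "l \<le> 1" "z = l * lo + (1 - l) * hi"
    proof -
      have "z \<in> closed_segment lo hi"
        using lo(1) hi(1) by (simp add: closed_segment_eq_real_ivl)
      then obtain r where r: "0 \<le> r" "r \<le> 1" "z = (1 - r) * lo + r * hi"
        by (auto simp: in_segment)
      show thesis
        using r by (intro that[of "1 - r"]) auto
    qed
    show "(u, z) \<in> convex hull normalised_graph \<alpha> \<beta> m"
      by (rule mixture_mem[OF convex_convex_hull lo(2) hi(2) l(1,2) _ l(3)])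
        (simp flip: distrib_right)
  qed
qed

section \<open>Undoing the normalisation\<close>

definition rescale :: "real ^ 'n \<Rightarrow> 'n \<Rightarrow> (real ^ 'n) \<times> real \<Rightarrow> (real ^ 'n) \<times> real" where
  "rescale b m = (\<lambda>(u, z). (\<chi> i. if i = m then u $ i else b $ i * u $ i, (\<Prod>j\<in>UNIV - {m}. b $ j) * z))"

lemma linear_rescale: "linear (rescale b m)"
  by (rule linearI) (auto simp: rescale_def vec_eq_iff algebra_simps)

lemma rescale_image_mem_iff:
  fixes b :: "real ^ 'n"
  assumes "\<And>i. 0 < b $ i"
  shows "(x, y) \<in> rescale b m ` S \<longleftrightarrow>
    (\<chi> i. if i = m then x $ i else x $ i / b $ i, y / (\<Prod>j\<in>UNIV - {m}. b $ j)) \<in> S"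
    (is "_ \<longleftrightarrow> ?p \<in> S")
proof -
  have P: "(\<Prod>j\<in>UNIV - {m}. b $ j) \<noteq> 0" and b: "\<And>i. b $ i \<noteq> 0"
    using assms by (auto simp: less_imp_neq[symmetric])
  have "rescale b m q = (x, y) \<longleftrightarrow> q = ?p" for q
    using P b by (cases q) (auto simp: rescale_def vec_eq_iff field_simps)
  then show ?thesis
    by (auto simp: image_iff eq_commute)
qed

lemma monomial_graph_eq_rescale:
  fixes a b :: "real ^ 'n"
  assumes b: "\<And>i. 0 < b $ i" and a: "\<And>i. i \<noteq> m \<Longrightarrow> a $ i = 0"
  shows "monomial_graph a b = rescale b m ` normalised_graph (a $ m) (b $ m) m"
proof (rule set_eqI, clarify)
  fix x y
  have P: "(\<Prod>j\<in>UNIV - {m}. b $ j) > 0" using b by (intro prod_pos) auto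
  have "(\<forall>i. a $ i \<le> x $ i \<and> x $ i \<le> b $ i) \<longleftrightarrow>
    a $ m \<le> x $ m \<and> x $ m \<le> b $ m \<and> (\<forall>i. i \<noteq> m \<longrightarrow> 0 \<le> x $ i / b $ i \<and> x $ i / b $ i \<le> 1)"
    using a b by (auto simp: divide_simps) (metis order_less_le_trans order_less_le)+
  moreover have "(\<Prod>i\<in>UNIV - {m}. if i = m then x $ i else x $ i / b $ i) =
    (\<Prod>i\<in>UNIV - {m}. x $ i) / (\<Prod>i\<in>UNIV - {m}. b $ i)"
    unfolding prod_dividef[symmetric] by (intro prod.cong) auto
  moreover have "(\<Prod>i\<in>UNIV. x $ i) = x $ m * (\<Prod>i\<in>UNIV - {m}. x $ i)"
    by (simp add: prod.remove[of UNIV m])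
  moreover have "y / (\<Prod>i\<in>UNIV - {m}. b $ i) =
      x $ m * ((\<Prod>i\<in>UNIV - {m}. x $ i) / (\<Prod>i\<in>UNIV - {m}. b $ i)) \<longleftrightarrow>
    y = x $ m * (\<Prod>i\<in>UNIV - {m}. x $ i)"
    using P by (simp only: times_divide_eq_right divide_cancel_right less_imp_neq[symmetric]) simp
  ultimately show "(x, y) \<in> monomial_graph a b \<longleftrightarrow>
      (x, y) \<in> rescale b m ` normalised_graph (a $ m) (b $ m) m"
    unfolding rescale_image_mem_iff[OF b] monomial_graph_def normalised_graph_def
    by auto
qed

text \<open>
  With \<open>x\<^sub>i = b\<^sub>i u\<^sub>i\<close> for \<open>i \<noteq> m\<close> and \<open>y = P z\<close>, where \<open>P\<close> is the product of the \<open>b\<^sub>i\<close> with \<open>i \<noteq> m\<close>, each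
  inequality bounding \<open>y\<close> is \<open>P\<close> times the corresponding normalised one.
\<close>

theorem theorem1:
  fixes a b :: "real ^ 'n" and m :: 'n
  assumes "CARD('n) \<ge> 2"
    and "\<And>i. 0 \<le> a $ i \<and> a $ i < b $ i"
    and "\<And>i. i \<noteq> m \<Longrightarrow> a $ i = 0"
  shows "monomial_hull a b =
    {(x, y).
       y - (\<Sum>i\<in>UNIV - {m}. (a $ m * (\<Prod>j\<in>UNIV - {i, m}. b $ j)) * x $ i)
         + (real CARD('n) - 2) * a $ m * (\<Prod>j\<in>UNIV - {m}. b $ j) \<ge> 0 \<and>
       y - (\<Sum>i\<in>UNIV. (\<Prod>j\<in>UNIV - {i}. b $ j) * x $ i)
         + (real CARD('n) - 1) * (\<Prod>j\<in>UNIV. b $ j) \<ge> 0 \<and>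
       (\<forall>i\<in>UNIV - {m}.
         - y + (a $ m * (\<Prod>j\<in>UNIV - {i, m}. b $ j)) * x $ i
           + (\<Prod>j\<in>UNIV - {m}. b $ j) * x $ m
           - a $ m * (\<Prod>j\<in>UNIV - {m}. b $ j) \<ge> 0) \<and>
       (\<forall>i\<in>UNIV - {m}. - y + (\<Prod>j\<in>UNIV - {i}. b $ j) * x $ i \<ge> 0) \<and>
       y \<ge> 0 \<and>
       (\<forall>i. x $ i \<le> b $ i) \<and>
       x $ m \<ge> a $ m}"
proof -
  define P where "P = (\<Prod>j\<in>UNIV - {m}. b $ j)"
  have b: "0 < b $ i" for i
    using assms(2)[of i] by linarith
  have P: "0 < P"
    unfolding P_def using b by (intro prod_pos) auto
  have prod_off: "(\<Prod>j\<in>UNIV - {i, m}. b $ j) = P / b $ i" if "i \<noteq> m" for i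
  proof -
    have "P = b $ i * (\<Prod>j\<in>UNIV - {m} - {i}. b $ j)"
      unfolding P_def using that by (intro prod.remove) auto
    moreover have "UNIV - {m} - {i} = UNIV - {i, m}" by auto
    ultimately show ?thesis using b[of i] by (simp add: field_simps)
  qed
  have prod_all: "(\<Prod>j\<in>UNIV. b $ j) = b $ m * P"
    unfolding P_def by (intro prod.remove) auto
  have prod_but: "(\<Prod>j\<in>UNIV - {i}. b $ j) = b $ m * P / b $ i" for i
    using prod.remove[of UNIV i "\<lambda>j. b $ j"] b[of i] prod_all by (simp add: field_simps)
  have "monomial_graph a b = rescale b m ` normalised_graph (a $ m) (b $ m) m"
    using b assms(3) by (rule monomial_graph_eq_rescale)
  then have "monomial_hull a b = rescale b m ` (convex hull normalised_graph (a $ m) (b $ m) m)"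
    by (simp add: monomial_hull_def convex_hull_linear_image[OF linear_rescale])
  also have "\<dots> = rescale b m ` normalised_system (a $ m) (b $ m) m"
    using assms(1,2) b by (subst convex_hull_normalised_graph) auto
  finally have hull: "monomial_hull a b = rescale b m ` normalised_system (a $ m) (b $ m) m" .
  show ?thesis
  proof (rule set_eqI, clarify, goal_cases)
    case (1 x y)
    define u where "u = (\<chi> i. if i = m then x $ i else x $ i / b $ i)"
    define z where "z = y / P"
    define A where "A = (\<Sum>i\<in>UNIV - {m}. u $ i)"
    have y: "y = P * z" using P by (simp add: z_def)
    have x: "x $ i = b $ i * u $ i" if "i \<noteq> m" for i
      using that b[of i] by (simp add: u_def)
    have x_m: "x $ m = u $ m" by (simp add: u_def)
    have slack: "slack m u = real CARD('n) - 1 - A"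
      using assms(1) by (simp add: slack_def A_def sum_subtractf card_Diff_singleton)
    have scale: "0 \<le> P * r \<longleftrightarrow> 0 \<le> r" for r
      using P by (simp add: zero_le_mult_iff)
    have sum1: "(\<Sum>i\<in>UNIV - {m}. (a $ m * (\<Prod>j\<in>UNIV - {i, m}. b $ j)) * x $ i) = a $ m * P * A"
      unfolding A_def sum_distrib_left
      using b by (intro sum.cong) (auto simp: prod_off x less_imp_neq[symmetric])
    have "(\<Sum>i\<in>UNIV. (\<Prod>j\<in>UNIV - {i}. b $ j) * x $ i) =
        P * u $ m + (\<Sum>i\<in>UNIV - {m}. (\<Prod>j\<in>UNIV - {i}. b $ j) * x $ i)"
      by (subst sum.remove[of UNIV m]) (auto simp: P_def x_m)
    also have "(\<Sum>i\<in>UNIV - {m}. (\<Prod>j\<in>UNIV - {i}. b $ j) * x $ i) = b $ m * P * A"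
      unfolding A_def sum_distrib_left
      using b by (intro sum.cong) (auto simp: prod_but x less_imp_neq[symmetric])
    finally have sum2: "(\<Sum>i\<in>UNIV. (\<Prod>j\<in>UNIV - {i}. b $ j) * x $ i) = P * u $ m + b $ m * P * A" .
    have ineq1: "y - (\<Sum>i\<in>UNIV - {m}. (a $ m * (\<Prod>j\<in>UNIV - {i, m}. b $ j)) * x $ i)
        + (real CARD('n) - 2) * a $ m * (\<Prod>j\<in>UNIV - {m}. b $ j) \<ge> 0
      \<longleftrightarrow> a $ m * (1 - slack m u) \<le> z"
      using scale[of "z - a $ m * (1 - slack m u)"]
      unfolding sum1 slack y P_def[symmetric] by (simp add: algebra_simps)
    have ineq2: "y - (\<Sum>i\<in>UNIV. (\<Prod>j\<in>UNIV - {i}. b $ j) * x $ i)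
        + (real CARD('n) - 1) * (\<Prod>j\<in>UNIV. b $ j) \<ge> 0
      \<longleftrightarrow> u $ m - b $ m * slack m u \<le> z"
      using scale[of "z - (u $ m - b $ m * slack m u)"]
      unfolding sum2 slack y prod_all by (simp add: algebra_simps)
    have all_off: "(\<forall>i\<in>UNIV - {m}. Q i) \<longleftrightarrow> (\<forall>i. i \<noteq> m \<longrightarrow> R i)"
      if "\<And>i. i \<noteq> m \<Longrightarrow> Q i \<longleftrightarrow> R i" for Q R
      using that by auto
    have ineq3: "(\<forall>i\<in>UNIV - {m}. - y + (a $ m * (\<Prod>j\<in>UNIV - {i, m}. b $ j)) * x $ i
        + (\<Prod>j\<in>UNIV - {m}. b $ j) * x $ m - a $ m * (\<Prod>j\<in>UNIV - {m}. b $ j) \<ge> 0)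
      \<longleftrightarrow> (\<forall>i. i \<noteq> m \<longrightarrow> z \<le> a $ m * u $ i + u $ m - a $ m)"
    proof (rule all_off, goal_cases)
      case (1 i)
      then show ?case
        using scale[of "a $ m * u $ i + u $ m - a $ m - z"] b[of i]
        by (simp add: prod_off x x_m y P_def[symmetric] algebra_simps)
    qed
    have ineq4: "(\<forall>i\<in>UNIV - {m}. - y + (\<Prod>j\<in>UNIV - {i}. b $ j) * x $ i \<ge> 0)
      \<longleftrightarrow> (\<forall>i. i \<noteq> m \<longrightarrow> z \<le> b $ m * u $ i)"
    proof (rule all_off, goal_cases)
      case (1 i)
      then show ?case
        using scale[of "b $ m * u $ i - z"] b[of i]
        by (simp add: prod_but x y algebra_simps)
    qed
    have ineq5: "y \<ge> 0 \<longleftrightarrow> 0 \<le> z"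
      using scale by (simp add: y)
    have ineq6: "(\<forall>i. x $ i \<le> b $ i) \<longleftrightarrow> (\<forall>i. i \<noteq> m \<longrightarrow> u $ i \<le> 1) \<and> u $ m \<le> b $ m"
    proof -
      have split_m: "(\<forall>i. Q i) \<longleftrightarrow> (\<forall>i. i \<noteq> m \<longrightarrow> Q i) \<and> Q m" for Q
        by (rule iffI, simp, rule allI, case_tac "i = m") auto
      have "x $ i \<le> b $ i \<longleftrightarrow> u $ i \<le> 1" if "i \<noteq> m" for i
        using that b[of i] by (simp add: u_def divide_le_eq)
      then show ?thesis
        unfolding split_m[of "\<lambda>i. x $ i \<le> b $ i"] x_m by (simp cong: imp_cong)
    qed
    have "(x, y) \<in> monomial_hull a b \<longleftrightarrow> (u, z) \<in> normalised_system (a $ m) (b $ m) m"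
      unfolding hull rescale_image_mem_iff[OF b] u_def z_def P_def ..
    then show ?case
      unfolding normalised_system_def mem_Collect_eq prod.case ineq1 ineq2 ineq3 ineq4 ineq5 ineq6
      unfolding x_m by argo
  qed
qed

end
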